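(* Let $q\in(0,1)$ and $m\ge1$. For any $\vec x,\vec y\in\mathbb{W}_m$, $$\lim_{T\to+\infty}\frac{\det\big[\Upsilon_1^{(T-1)}(y_i,m-j)\big]_{i,j=1}^m}{\det\big[\Upsilon_1^{(T)}(x_i,m-j)\big]_{i,j=1}^m}=q^{-\binom m2+(m-1)(|\vec x|-|\vec y|)}\prod_{1\le i<j\le m}\frac{q^{y_j}-q^{y_i}}{q^{x_j}-q^{x_i}}.$$
   Context: $\mathbb{W}_m=\{\vec x=(x_1>x_2>\dots>x_m\ge0)\}\subset\mathbb{Z}_{\ge0}^m$, and $|\vec x|=x_1+\dots+x_m$. $\Upsilon_1$ is the one-step Markov transition probability on $\mathbb{Z}_{\ge0}$ given by $\Upsilon_1(x,x)=q^x$, $\Upsilon_1(x,x-1)=1-q^x$, and $\Upsilon_1(x,y)=0$ otherwise (the $q$-exchangeable random walk). $\Upsilon_1^{(T)}$ denotes its $T$-step transition probability; explicitly, for $T\ge x-y$, $$\Upsilon_1^{(T)}(x,y)=\mathbf{1}_{0\le y\le x}\,(1-q^x)(1-q^{x-1})\cdots(1-q^{y+1})\,q^{y(T-x+y)}\,\frac{(q;q)_T}{(q;q)_{x-y}(q;q)_{T-x+y}},$$ where $(a;q)_k=\prod_{i=0}^{k-1}(1-aq^i)$. (By the Karlin--McGregor formula these determinants are the probabilities that independent walks reach $(m-1,\dots,1,0)$ without colliding.) *)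

theory Defs
  imports Complex_Main "HOL-Analysis.Infinite_Sum" "Jordan_Normal_Form.Determinant"
begin

text \<open>Strictly decreasing vectors of \<open>m\<close> non-negative integers. Vectors are indexed from \<open>0\<close>,
  so \<open>x $ i\<close> is the coordinate \<open>x\<^sub>i\<^sub>+\<^sub>1\<close> of the 1-based notation.\<close>

definition weyl_chamber :: "nat \<Rightarrow> nat vec set" where
  "weyl_chamber m = {x \<in> carrier_vec m. \<forall>i j. i < j \<and> j < m \<longrightarrow> x $ i > x $ j}"

definition vec_size :: "nat vec \<Rightarrow> nat" where
  "vec_size x = (\<Sum>i<dim_vec x. x $ i)"

text \<open>The \<open>q\<close>-exchangeable random walk. The second case is \<open>y = x - 1\<close>; at \<open>x = 0\<close> the walk stays put,
  since \<open>q ^ 0 = 1\<close>.\<close>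

definition Upsilon1 :: "real \<Rightarrow> nat \<Rightarrow> nat \<Rightarrow> real" where
  "Upsilon1 q x y = (if y = x then q ^ x else if Suc y = x then 1 - q ^ x else 0)"

text \<open>Multi-step transition probabilities of a transition kernel on the non-negative integers.
  For \<open>Upsilon1\<close> every sum over the intermediate state has at most two nonzero terms, so the
  convention that \<open>infsum\<close> is \<open>0\<close> on non-summable families plays no role.\<close>

primrec kernel_power :: "(nat \<Rightarrow> nat \<Rightarrow> real) \<Rightarrow> nat \<Rightarrow> nat \<Rightarrow> nat \<Rightarrow> real" where
  "kernel_power P 0 x z = (if x = z then 1 else 0)"
| "kernel_power P (Suc T) x z = (\<Sum>\<^sub>\<infinity>y\<in>UNIV. P x y * kernel_power P T y z)"

text \<open>The Karlin--McGregor determinant for \<open>T\<close> steps from \<open>x\<close> to \<open>(m-1, \<dots>, 1, 0)\<close>. In the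
  0-based indexing, column \<open>j\<close> has the target \<open>m - (j+1)\<close>.\<close>

definition km_det :: "real \<Rightarrow> nat \<Rightarrow> nat \<Rightarrow> nat vec \<Rightarrow> real" where
  "km_det q m T x =
     det (mat m m (\<lambda>(i, j). kernel_power (Upsilon1 q) T (x $ i) (m - Suc j)))"

end

theory Submission
  imports Defs
begin

text \<open>Put \<open>u = 1/q\<close>. The polynomial \<open>f\<^sub>k(w) = (w - 1) (w - u) \<dots> (w - u\<^bsup>k-1\<^esup>)\<close>, evaluated at \<open>w = u\<^bsup>x\<^esup>\<close>,
  is an eigenfunction of the walk with eigenvalue \<open>q\<^bsup>k\<^esup>\<close>; it vanishes for \<open>x < k\<close> and is nonnegative.
  Hence the probability of being at \<open>z\<close> after \<open>T\<close> steps is \<open>O(q\<^bsup>zT\<^esup>)\<close>. Multiplying the matrix of transition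
  probabilities to \<open>m - 1, \<dots>, 0\<close> by the triangular matrix of the values \<open>f\<^sub>k(u\<^bsup>z\<^esup>) / q\<^bsup>kT\<^esup>\<close> gives, up to the
  terms \<open>z \<ge> m\<close> missing from the eigenvalue equation, the matrix of the \<open>f\<^sub>k(u^(x\<^sub>i))\<close>. The missing terms
  tend to 0, and the limit is a Vandermonde determinant in the \<open>u^(x\<^sub>i)\<close>.\<close>

section \<open>Determinants of evaluated monic polynomials, and limits of determinants\<close>

lemma newton_basis_expansion:
  fixes p :: "'a::comm_ring_1 poly"
  assumes "\<And>k. degree (b k) = k" and "\<And>k. coeff (b k) k = 1"
    and "\<And>i. i \<ge> k \<Longrightarrow> coeff p i = 0"
  shows "\<exists>u. p = (\<Sum>l<k. smult (u l) (b l))"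
  using assms(3)
proof (induction k arbitrary: p)
  case 0
  then show ?case by (auto simp: poly_eq_iff)
next
  case (Suc k)
  define p' where "p' = p - smult (coeff p k) (b k)"
  have "coeff p' i = 0" if "i \<ge> k" for i
    using Suc.prems[of i] that assms(1,2)[of k]
    by (cases "i = k") (auto simp: p'_def coeff_eq_0)
  then obtain u where u: "p' = (\<Sum>l<k. smult (u l) (b l))"
    using Suc.IH by blast
  have "p = p' + smult (coeff p k) (b k)"
    by (simp add: p'_def)
  also have "\<dots> = (\<Sum>l<Suc k. smult ((u(k := coeff p k)) l) (b l))"
    by (simp add: u)
  finally show ?case by blast
qed

text \<open>A unitriangular change of basis between monic families preserves the determinant, so the
  \<open>p k\<close> may be replaced by a Newton basis adapted to the nodes. Degrees fall from
  \<open>m - 1\<close> to 0 along the columns, matching the order of the walk's targets.\<close>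

lemma det_monic_poly_eval:
  fixes a :: "nat \<Rightarrow> 'a::idom" and p :: "nat \<Rightarrow> 'a poly"
  assumes deg: "\<And>k. degree (p k) = k" and monic: "\<And>k. coeff (p k) k = 1"
  shows "det (mat m m (\<lambda>(i, j). poly (p (m - Suc j)) (a i)))
    = (\<Prod>i<m. \<Prod>t\<in>{Suc i..<m}. (a i - a t))"
proof -
  txt \<open>The Newton basis on the nodes in reverse order: evaluated at the \<open>a i\<close> it is upper
    triangular, so no sign of a column reversal appears.\<close>
  define c where "c = (\<lambda>t. a (m - Suc t))"
  define b where "b = (\<lambda>k. \<Prod>t<k. [:- c t, 1:])"
  have b_monic: "degree (b k) = k \<and> coeff (b k) k = 1" for k
  proof -
    have "degree (b k) = k"
      unfolding b_def by (subst degree_prod_eq_sum_degree) auto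
    moreover have "lead_coeff (b k) = 1"
      unfolding b_def lead_coeff_prod by simp
    ultimately show ?thesis by simp
  qed
  have "\<exists>u. p k - b k = (\<Sum>l<k. smult (u l) (b l))" for k
  proof (rule newton_basis_expansion)
    fix i assume "k \<le> i"
    then show "coeff (p k - b k) i = 0"
      using b_monic[of k] deg[of k] monic[of k] by (cases "i = k") (auto simp: coeff_eq_0)
  qed (use b_monic in auto)
  then obtain u where u: "\<And>k. p k - b k = (\<Sum>l<k. smult (u k l) (b l))"
    by metis
  define v where "v = (\<lambda>k l. if l < k then u k l else if l = k then 1 else 0)"
  have pk: "poly (p k) x = (\<Sum>l<m. poly (b l) x * v k l)" if "k < m" for k x
  proof -
    have "(\<Sum>l<m. poly (b l) x * v k l) = (\<Sum>l<Suc k. poly (b l) x * v k l)"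
      using that by (intro sum.mono_neutral_right) (auto simp: v_def)
    also have "\<dots> = poly (\<Sum>l<k. smult (u k l) (b l)) x + poly (b k) x"
      by (simp add: v_def poly_sum mult.commute)
    also have "\<dots> = poly (p k) x"
      by (simp flip: u)
    finally show ?thesis by simp
  qed
  define N where "N = mat m m (\<lambda>(i, j). poly (b (m - Suc j)) (a i))"
  define V where "V = mat m m (\<lambda>(l, j). v (m - Suc j) (m - Suc l))"
  have "mat m m (\<lambda>(i, j). poly (p (m - Suc j)) (a i)) = N * V"
  proof (rule eq_matI)
    fix i j assume ij: "i < dim_row (N * V)" "j < dim_col (N * V)"
    then have "(N * V) $$ (i, j)
        = (\<Sum>l<m. poly (b (m - Suc l)) (a i) * v (m - Suc j) (m - Suc l))"
      by (simp add: N_def V_def scalar_prod_def lessThan_atLeast0)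
    also have "\<dots> = (\<Sum>l<m. poly (b l) (a i) * v (m - Suc j) l)"
      by (rule sum.nat_diff_reindex)
    finally show "mat m m (\<lambda>(i, j). poly (p (m - Suc j)) (a i)) $$ (i, j) = (N * V) $$ (i, j)"
      using ij by (simp add: pk N_def V_def)
  qed (auto simp: N_def V_def)
  then have "det (mat m m (\<lambda>(i, j). poly (p (m - Suc j)) (a i))) = det N * det V"
    by (simp add: det_mult[of _ m] N_def V_def)
  also have "det V = 1"
    by (subst det_lower_triangular[of m])
      (auto simp: V_def v_def prod_list_diag_prod)
  also have "det N = (\<Prod>i<m. poly (b (m - Suc i)) (a i))"
  proof (subst det_upper_triangular[of _ m])
    show "upper_triangular N"
    proof (rule upper_triangularI)
      fix i j assume *: "j < i" "i < dim_row N"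
      \<comment> \<open>The node with index \<open>m - Suc i\<close> is \<open>a i\<close>, and it
        occurs among the roots of \<open>b (m - Suc j)\<close>.\<close>
      then have "m - Suc i < m - Suc j" "c (m - Suc i) = a i"
        by (auto simp: N_def c_def)
      then show "N $$ (i, j) = 0"
        using * by (auto simp: N_def b_def poly_prod intro!: bexI[of _ "m - Suc i"])
    qed
  qed (auto simp: N_def prod_list_diag_prod lessThan_atLeast0)
  also have "\<dots> = (\<Prod>i<m. \<Prod>t\<in>{Suc i..<m}. (a i - a t))"
  proof (rule prod.cong)
    fix i assume "i \<in> {..<m}"
    then show "poly (b (m - Suc i)) (a i) = (\<Prod>t\<in>{Suc i..<m}. (a i - a t))"
      unfolding b_def poly_prod c_def
      by (intro prod.reindex_bij_witness[of _ "\<lambda>t. m - Suc t" "\<lambda>t. m - Suc t"]) auto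
  qed simp
  finally show ?thesis by simp
qed

lemma tendsto_det:
  fixes F :: "'b \<Rightarrow> 'a::{real_normed_field} mat"
  assumes "\<And>i j. i < n \<Longrightarrow> j < n \<Longrightarrow> ((\<lambda>t. F t $$ (i, j)) \<longlongrightarrow> A $$ (i, j)) net"
    and "\<And>t. F t \<in> carrier_mat n n" and "A \<in> carrier_mat n n"
  shows "((\<lambda>t. det (F t)) \<longlongrightarrow> det A) net"
proof -
  have "((\<lambda>t. \<Sum>p | p permutes {0..<n}. signof p * (\<Prod>i = 0..<n. F t $$ (i, p i)))
      \<longlongrightarrow> (\<Sum>p | p permutes {0..<n}. signof p * (\<Prod>i = 0..<n. A $$ (i, p i)))) net"
    by (intro tendsto_sum tendsto_mult tendsto_const tendsto_prod assms(1))
      (auto dest: permutes_in_image)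
  then show ?thesis
    by (simp only: det_def'[OF assms(2)] det_def'[OF assms(3)])
qed

section \<open>Products and sums over index pairs\<close>

lemma prod_pairs_row:
  "(\<Prod>(i, j)\<in>{(i, j). i < j \<and> j < (m::nat)}. f i j) = (\<Prod>i<m. \<Prod>j\<in>{Suc i..<m}. f i j)"
  by (subst prod.Sigma) (auto intro!: prod.cong)

text \<open>Each index lies in exactly \<open>m - 1\<close> pairs; this is the source of the factor
  \<open>m - 1\<close> in the final exponent of \<open>q\<close>.\<close>

lemma sum_pairs_add:
  fixes f :: "nat \<Rightarrow> nat"
  shows "(\<Sum>(i, j)\<in>{(i, j). i < j \<and> j < m}. f i + f j) = (m - 1) * (\<Sum>i<m. f i)"
proof -
  have "(\<Sum>(i, j)\<in>{(i, j). i < j \<and> j < m}. f i + f j) = (\<Sum>j<m. \<Sum>i<j. f i + f j)"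
    by (subst sum.Sigma)
      (auto intro!: sum.reindex_bij_witness[of _ "\<lambda>(j, i). (i, j)" "\<lambda>(i, j). (j, i)"])
  also have "\<dots> = (m - 1) * (\<Sum>i<m. f i)"
  proof (induction m)
    case (Suc m)
    then show ?case by (cases m) (auto simp: sum.distrib algebra_simps)
  qed simp
  finally show ?thesis .
qed

section \<open>The u-analogue of the falling factorial, up to normalisation\<close>

definition falling_poly :: "'a::comm_ring_1 \<Rightarrow> nat \<Rightarrow> 'a poly" where
  "falling_poly u k = (\<Prod>r<k. [:- (u ^ r), 1:])"

lemma degree_falling_poly [simp]: "degree (falling_poly (u::'a::idom) k) = k"
  unfolding falling_poly_def by (subst degree_prod_eq_sum_degree) auto

lemma monic_falling_poly: "coeff (falling_poly (u::'a::idom) k) k = 1"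
proof -
  have "lead_coeff (falling_poly u k) = 1"
    unfolding falling_poly_def lead_coeff_prod by simp
  then show ?thesis by simp
qed

text \<open>Since \<open>u ^ Suc x - u ^ Suc r = u * (u ^ x - u ^ r)\<close>, moving from
  \<open>x\<close> to \<open>Suc x\<close> shifts the factors by one place, and only the two extreme
  ones fail to match. Keeping those on opposite sides avoids division.\<close>

lemma falling_poly_shift:
  "(u ^ Suc x - u ^ k) * poly (falling_poly u k) (u ^ Suc x)
    = u ^ k * (u ^ Suc x - 1) * poly (falling_poly u k) (u ^ x)"
proof (induction k)
  case 0
  then show ?case by (simp add: falling_poly_def)
next
  case (Suc k)
  have *: "poly (falling_poly u (Suc k)) w = poly (falling_poly u k) w * (w - u ^ k)" for w
    by (simp add: falling_poly_def algebra_simps)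
  have "(u ^ Suc x - u ^ Suc k) * poly (falling_poly u (Suc k)) (u ^ Suc x)
      = (u ^ Suc x - u ^ Suc k) * ((u ^ Suc x - u ^ k) * poly (falling_poly u k) (u ^ Suc x))"
    by (simp only: * ac_simps)
  also have "\<dots> = u ^ Suc k * (u ^ Suc x - 1) * poly (falling_poly u (Suc k)) (u ^ x)"
    by (simp only: Suc.IH *) (simp add: algebra_simps)
  finally show ?case .
qed

lemma poly_falling_poly_eq_0:
  "x < k \<Longrightarrow> poly (falling_poly (u::'a::idom) k) (u ^ x) = 0"
  by (auto simp: falling_poly_def poly_prod)

lemma poly_falling_poly_nonneg:
  "1 \<le> (u::real) \<Longrightarrow> 0 \<le> poly (falling_poly u k) (u ^ x)"
proof (cases "x < k")
  case False
  assume "1 \<le> u"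
  with False show ?thesis
    by (auto simp: falling_poly_def poly_prod intro!: prod_nonneg power_increasing)
qed (simp add: poly_falling_poly_eq_0)

lemma poly_falling_poly_pos:
  "1 < (u::real) \<Longrightarrow> 0 < poly (falling_poly u k) (u ^ k)"
  by (auto simp: falling_poly_def poly_prod intro!: prod_pos power_strict_increasing)

section \<open>Eigenfunctions of the walk\<close>

lemma kernel_power_Suc_Upsilon1:
  "kernel_power (Upsilon1 q) (Suc T) x z
    = q ^ x * kernel_power (Upsilon1 q) T x z
      + (1 - q ^ x) * kernel_power (Upsilon1 q) T (x - 1) z"
proof -
  let ?f = "\<lambda>y. Upsilon1 q x y * kernel_power (Upsilon1 q) T y z"
  have "(\<Sum>\<^sub>\<infinity>y\<in>UNIV. ?f y) = (\<Sum>\<^sub>\<infinity>y\<in>{x, x - 1}. ?f y)"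
    by (rule infsum_cong_neutral) (auto simp: Upsilon1_def)
  also have "\<dots> = (\<Sum>y\<in>{x, x - 1}. ?f y)"
    by simp
  \<comment> \<open>At \<open>x = 0\<close> the set is a singleton, while on the right the term with
    the truncated \<open>x - 1\<close> has coefficient \<open>1 - q ^ 0 = 0\<close>.\<close>
  also have "\<dots> = q ^ x * kernel_power (Upsilon1 q) T x z
      + (1 - q ^ x) * kernel_power (Upsilon1 q) T (x - 1) z"
    by (cases x) (auto simp: Upsilon1_def)
  finally show ?thesis by simp
qed

lemma kernel_power_Upsilon1_nonneg:
  assumes "0 \<le> q" "q \<le> 1"
  shows "0 \<le> kernel_power (Upsilon1 q) T x z"
proof (induction T arbitrary: x)
  case (Suc T)
  then show ?case
    using assms by (simp add: kernel_power_Suc_Upsilon1 power_le_one del: kernel_power.simps(2))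
qed simp

text \<open>For positive \<open>x\<close> this is the shift identity multiplied by
  \<open>q ^ x * q ^ k\<close>. At \<open>x = 0\<close> the walk stays put, and the polynomial
  vanishes at 1 unless \<open>k = 0\<close>.\<close>

lemma falling_poly_eigenfunction:
  fixes q :: real
  assumes "q \<noteq> 0"
  defines "u \<equiv> inverse q"
  shows "q ^ x * poly (falling_poly u k) (u ^ x)
      + (1 - q ^ x) * poly (falling_poly u k) (u ^ (x - 1))
    = q ^ k * poly (falling_poly u k) (u ^ x)"
proof (cases x)
  case 0
  then show ?thesis
    using poly_falling_poly_eq_0[of 0 k u] by (cases k) auto
next
  case (Suc n)
  have "q ^ x * q ^ k * ((u ^ Suc n - u ^ k) * poly (falling_poly u k) (u ^ Suc n))
      = q ^ x * q ^ k * (u ^ k * (u ^ Suc n - 1) * poly (falling_poly u k) (u ^ n))"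
    by (simp only: falling_poly_shift)
  moreover have "q ^ x * u ^ Suc n = 1" "q ^ k * u ^ k = 1"
    using assms(1) by (simp_all add: Suc u_def flip: power_mult_distrib power_Suc)
  \<comment> \<open>Pure ring algebra, to be read with \<open>X = q ^ x\<close>,
    \<open>K = q ^ k\<close>, \<open>a = u ^ Suc n\<close>, \<open>b = u ^ k\<close>.\<close>
  moreover have "(K - X) * F = (1 - X) * G"
    if "X * K * ((a - b) * F) = X * K * (b * (a - 1) * G)" "X * a = 1" "K * b = 1"
    for X K a b F G :: real
  proof -
    have "(K * (X * a) - X * (K * b)) * F = K * b * (X * a - X) * G"
      using that(1) by (simp add: algebra_simps)
    then show ?thesis
      by (simp add: that(2,3))
  qed
  ultimately have "(q ^ k - q ^ x) * poly (falling_poly u k) (u ^ Suc n)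
      = (1 - q ^ x) * poly (falling_poly u k) (u ^ n)"
    by blast
  then show ?thesis
    by (simp add: Suc algebra_simps)
qed

text \<open>The walk never moves up, so the sum up to any \<open>n\<close> with
  \<open>x \<le> n\<close> is already the full expectation after \<open>T\<close> steps. Fixing
  \<open>n\<close> lets the induction apply to both \<open>x\<close> and
  \<open>x - 1\<close>.\<close>

lemma kernel_power_eigenfunction:
  fixes q :: real
  assumes "q \<noteq> 0" "x \<le> n"
  defines "u \<equiv> inverse q"
  shows "(\<Sum>z\<le>n. kernel_power (Upsilon1 q) T x z * poly (falling_poly u k) (u ^ z))
    = q ^ (k * T) * poly (falling_poly u k) (u ^ x)"
  using assms(2)
proof (induction T arbitrary: x)
  case 0
  then show ?case
    by (simp add: if_distrib[of "\<lambda>c. c * _"] cong: if_cong)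
next
  case (Suc T)
  have "(\<Sum>z\<le>n. kernel_power (Upsilon1 q) (Suc T) x z * poly (falling_poly u k) (u ^ z))
      = q ^ x * (\<Sum>z\<le>n. kernel_power (Upsilon1 q) T x z * poly (falling_poly u k) (u ^ z))
      + (1 - q ^ x) * (\<Sum>z\<le>n. kernel_power (Upsilon1 q) T (x - 1) z * poly (falling_poly u k) (u ^ z))"
    unfolding kernel_power_Suc_Upsilon1
    by (simp add: sum.distrib sum_distrib_left algebra_simps sum_subtractf)
  also have "\<dots> = q ^ (k * T) * (q ^ x * poly (falling_poly u k) (u ^ x)
      + (1 - q ^ x) * poly (falling_poly u k) (u ^ (x - 1)))"
    using Suc.IH[OF Suc.prems] Suc.IH[of "x - 1"] Suc.prems by (simp only: ring_distribs) simp
  also have "\<dots> = q ^ (k * Suc T) * poly (falling_poly u k) (u ^ x)"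
    using falling_poly_eigenfunction[OF assms(1), of x k] by (simp add: u_def power_add)
  finally show ?case .
qed

section \<open>Long-time limits of transition probabilities and determinants\<close>

lemma kernel_power_decay:
  fixes q :: real
  assumes q: "0 < q" "q < 1" and "k < z"
  shows "(\<lambda>T. kernel_power (Upsilon1 q) T x z / q ^ (k * T)) \<longlonglongrightarrow> 0"
proof -
  define u where "u = inverse q"
  have u: "1 < u"
    using q by (simp add: u_def one_less_inverse)
  \<comment> \<open>The degree is \<open>z\<close>, not \<open>k\<close>: its eigenvalue
    \<open>q ^ z\<close> beats \<open>q ^ k\<close>, and \<open>f z\<close> is positive, so the
    single term at \<open>z\<close> can be isolated from a sum of nonnegative terms.\<close>
  define f where "f = (\<lambda>y. poly (falling_poly u z) (u ^ y))"
  define n where "n = max x z"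
  have f: "0 \<le> f y" "0 < f z" for y
    using u by (auto simp: f_def poly_falling_poly_nonneg poly_falling_poly_pos)
  have K: "0 \<le> kernel_power (Upsilon1 q) T x y" for T y
    using q by (simp add: kernel_power_Upsilon1_nonneg)
  have bound: "kernel_power (Upsilon1 q) T x z / q ^ (k * T) \<le> f x / f z * (q ^ (z - k)) ^ T" for T
  proof -
    have "kernel_power (Upsilon1 q) T x z * f z
        \<le> (\<Sum>y\<le>n. kernel_power (Upsilon1 q) T x y * f y)"
      by (rule member_le_sum) (auto simp: n_def f K)
    also have "\<dots> = q ^ (z * T) * f x"
      using kernel_power_eigenfunction[of q x n T z] q
      by (simp add: n_def f_def u_def)
    also have "q ^ (z * T) = (q ^ (z - k)) ^ T * q ^ (k * T)"
      using \<open>k < z\<close> by (simp flip: power_mult power_add add_mult_distrib)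
    finally show ?thesis
      using q f(2) by (simp add: field_simps)
  qed
  have "(\<lambda>T. f x / f z * (q ^ (z - k)) ^ T) \<longlonglongrightarrow> f x / f z * 0"
    using q \<open>k < z\<close> by (intro tendsto_mult tendsto_const LIMSEQ_power_zero)
      (simp add: power_less_one_iff)
  then have lim: "(\<lambda>T. f x / f z * (q ^ (z - k)) ^ T) \<longlonglongrightarrow> 0"
    by simp
  show ?thesis
    by (rule tendsto_sandwich[OF _ _ tendsto_const lim]) (use K q bound in auto)
qed

lemma kernel_power_truncated_limit:
  fixes q :: real
  assumes q: "0 < q" "q < 1" and "k < m"
  defines "u \<equiv> inverse q"
  shows "(\<lambda>T. \<Sum>z<m. kernel_power (Upsilon1 q) T x z * (poly (falling_poly u k) (u ^ z) / q ^ (k * T)))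
    \<longlonglongrightarrow> poly (falling_poly u k) (u ^ x)"
proof -
  define f where "f = (\<lambda>y. poly (falling_poly u k) (u ^ y))"
  \<comment> \<open>The maximum lets \<open>{..n}\<close> split at \<open>m\<close> even if
    \<open>x < m\<close>. All states in the tail satisfy \<open>k < m \<le> z\<close>, so each tail
    term decays.\<close>
  define n where "n = max x m"
  have "(\<Sum>z<m. kernel_power (Upsilon1 q) T x z * (f z / q ^ (k * T)))
      = f x - (\<Sum>z\<in>{m..n}. kernel_power (Upsilon1 q) T x z / q ^ (k * T) * f z)" for T
  proof -
    let ?g = "\<lambda>z. kernel_power (Upsilon1 q) T x z * f z / q ^ (k * T)"
    have "(\<Sum>z\<le>n. ?g z) = f x"
      using kernel_power_eigenfunction[of q x n T k] q
      by (simp add: n_def f_def u_def flip: sum_divide_distrib)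
    moreover have "{..n} = {..<m} \<union> {m..n}"
      by (auto simp: n_def)
    then have "(\<Sum>z\<le>n. ?g z) = (\<Sum>z<m. ?g z) + (\<Sum>z\<in>{m..n}. ?g z)"
      by (simp only:) (rule sum.union_disjoint; auto)
    ultimately show ?thesis
      by (simp add: algebra_simps)
  qed
  moreover have "(\<lambda>T. f x - (\<Sum>z\<in>{m..n}. kernel_power (Upsilon1 q) T x z / q ^ (k * T) * f z))
      \<longlonglongrightarrow> f x - (\<Sum>z\<in>{m..n}. 0 * f z)"
    by (intro tendsto_intros kernel_power_decay) (use q \<open>k < m\<close> in auto)
  ultimately show ?thesis
    by (simp add: f_def)
qed

text \<open>Column normalisations \<open>q ^ (k * T)\<close> for \<open>k < m\<close> multiply to
  \<open>(q ^ (m choose 2)) ^ T\<close>, because \<open>0 + 1 + ... + (m - 1)\<close> is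
  \<open>m choose 2\<close>. The product of polynomial values comes from the diagonal of the
  triangular factor and is independent of \<open>x\<close> and \<open>T\<close>.\<close>

lemma km_det_asymptotics:
  fixes q :: real
  assumes q: "0 < q" "q < 1"
  shows "(\<lambda>T. km_det q m T x
      * (\<Prod>k<m. poly (falling_poly (inverse q) k) (inverse q ^ k)) / (q ^ (m choose 2)) ^ T)
    \<longlonglongrightarrow> (\<Prod>(i, j)\<in>{(i, j). i < j \<and> j < m}. (inverse q ^ (x $ i) - inverse q ^ (x $ j)))"
proof -
  define u where "u = inverse q"
  define f where "f = (\<lambda>k y. poly (falling_poly u k) (u ^ y))"
  define A where "A = (\<lambda>T. mat m m (\<lambda>(i, j). kernel_power (Upsilon1 q) T (x $ i) (m - Suc j)))"
  define B where "B = (\<lambda>T. mat m m (\<lambda>(l, j). f (m - Suc j) (m - Suc l) / q ^ ((m - Suc j) * T)))"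
  define L where "L = mat m m (\<lambda>(i, j). poly (falling_poly u (m - Suc j)) (u ^ (x $ i)))"
  have lim: "(\<lambda>T. det (A T * B T)) \<longlonglongrightarrow> det L"
  proof (rule tendsto_det)
    fix i j assume ij: "i < m" "j < m"
    have "(A T * B T) $$ (i, j) = (\<Sum>z<m. kernel_power (Upsilon1 q) T (x $ i) z
        * (f (m - Suc j) z / q ^ ((m - Suc j) * T)))" for T
    proof -
      have "(A T * B T) $$ (i, j) = (\<Sum>l<m. kernel_power (Upsilon1 q) T (x $ i) (m - Suc l)
          * (f (m - Suc j) (m - Suc l) / q ^ ((m - Suc j) * T)))"
        using ij by (simp add: A_def B_def scalar_prod_def lessThan_atLeast0)
      also have "\<dots> = (\<Sum>z<m. kernel_power (Upsilon1 q) T (x $ i) z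
          * (f (m - Suc j) z / q ^ ((m - Suc j) * T)))"
        by (rule sum.nat_diff_reindex)
      finally show ?thesis .
    qed
    then show "(\<lambda>T. (A T * B T) $$ (i, j)) \<longlonglongrightarrow> L $$ (i, j)"
      using kernel_power_truncated_limit[of q "m - Suc j" m "x $ i"] q ij
      by (simp add: L_def f_def u_def)
  qed (auto simp: A_def B_def L_def)
  have detB: "det (B T) = (\<Prod>k<m. f k k) / (q ^ (m choose 2)) ^ T" for T
  proof -
    have "det (B T) = (\<Prod>l<m. f (m - Suc l) (m - Suc l) / q ^ ((m - Suc l) * T))"
    proof (subst det_upper_triangular[of _ m])
      \<comment> \<open>Below the diagonal the state \<open>m - Suc l\<close> is smaller than the
        degree \<open>m - Suc j\<close>.\<close>
      show "upper_triangular (B T)"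
        by (auto simp: B_def f_def upper_triangular_def intro!: poly_falling_poly_eq_0)
    qed (auto simp: B_def prod_list_diag_prod lessThan_atLeast0)
    also have "\<dots> = (\<Prod>k<m. f k k / q ^ (k * T))"
      by (rule prod.nat_diff_reindex)
    also have "\<dots> = (\<Prod>k<m. f k k) / q ^ ((\<Sum>k<m. k) * T)"
      by (simp add: prod_dividef power_sum sum_distrib_right)
    also have "(\<Sum>k<m. k) = m choose 2"
      by (simp add: choose_two Sum_Ico_nat lessThan_atLeast0)
    finally show ?thesis
      by (simp add: power_mult)
  qed
  have "det (A T * B T) = km_det q m T x * (\<Prod>k<m. f k k) / (q ^ (m choose 2)) ^ T" for T
    using det_mult[of "A T" m "B T"] detB[of T] by (simp add: A_def B_def km_det_def)
  moreover have "det L = (\<Prod>(i, j)\<in>{(i, j). i < j \<and> j < m}. (u ^ (x $ i) - u ^ (x $ j)))"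
    unfolding L_def prod_pairs_row
    by (rule det_monic_poly_eval) (simp_all add: monic_falling_poly)
  ultimately show ?thesis
    using lim by (simp add: f_def u_def)
qed

section \<open>From powers of \<open>inverse q\<close> back to \<open>q\<close>, and the limit of
  the ratio\<close>

lemma prod_inverse_power_differences:
  fixes q :: real
  assumes "q \<noteq> 0" and "x \<in> carrier_vec m"
  shows "(\<Prod>(i, j)\<in>{(i, j). i < j \<and> j < m}. (inverse q ^ (x $ i) - inverse q ^ (x $ j)))
    = (\<Prod>(i, j)\<in>{(i, j). i < j \<and> j < m}. (q ^ (x $ j) - q ^ (x $ i)))
      / q ^ ((m - 1) * vec_size x)"
proof -
  let ?S = "{(i, j). i < j \<and> j < m}"
  have "(\<Prod>(i, j)\<in>?S. (inverse q ^ (x $ i) - inverse q ^ (x $ j)))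
      = (\<Prod>(i, j)\<in>?S. (q ^ (x $ j) - q ^ (x $ i)) / q ^ (x $ i + x $ j))"
    using assms(1) by (intro prod.cong) (auto simp: field_simps power_add)
  also have "\<dots> = (\<Prod>(i, j)\<in>?S. (q ^ (x $ j) - q ^ (x $ i))) / (\<Prod>(i, j)\<in>?S. q ^ (x $ i + x $ j))"
    by (simp add: case_prod_unfold prod_dividef)
  also have "(\<Prod>(i, j)\<in>?S. q ^ (x $ i + x $ j)) = q ^ (\<Sum>(i, j)\<in>?S. x $ i + x $ j)"
    by (simp add: case_prod_unfold power_sum)
  also have "(\<Sum>(i, j)\<in>?S. x $ i + x $ j) = (m - 1) * vec_size x"
    using assms(2) by (simp add: sum_pairs_add vec_size_def)
  finally show ?thesis .
qed

theorem proposition2p6: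
  fixes q :: real and m :: nat and x y :: "nat vec"
  assumes "0 < q" and "q < 1" and "m \<ge> 1"
    and "x \<in> weyl_chamber m" and "y \<in> weyl_chamber m"
  shows "(\<lambda>T. km_det q m (T - 1) y / km_det q m T x)
    \<longlonglongrightarrow> q powi (- int (m choose 2) + (int m - 1) * (int (vec_size x) - int (vec_size y)))
        * (\<Prod>(i, j)\<in>{(i, j). i < j \<and> j < m}.
             (q ^ (y $ j) - q ^ (y $ i)) / (q ^ (x $ j) - q ^ (x $ i)))"
proof -
  let ?S = "{(i, j). i < j \<and> j < m}"
  define r where "r = q ^ (m choose 2)"
  define C where "C = (\<Prod>k<m. poly (falling_poly (inverse q) k) (inverse q ^ k))"
  define L where "L = (\<lambda>x. \<Prod>(i, j)\<in>?S. (inverse q ^ (x $ i) - inverse q ^ (x $ j)))"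
  define M where "M = (\<lambda>x. \<Prod>(i, j)\<in>?S. (q ^ (x $ j) - q ^ (x $ i)))"
  define F where "F = (\<lambda>x T. km_det q m T x * C / r ^ T)"
  have F: "F z \<longlonglongrightarrow> L z" for z
    unfolding F_def L_def C_def r_def by (rule km_det_asymptotics[OF assms(1,2)])
  have r: "r \<noteq> 0" and C: "C \<noteq> 0"
    using assms(1,2) poly_falling_poly_pos[OF one_less_inverse[OF assms(1,2)]]
    by (auto simp: r_def C_def less_le)
  have L: "L z = M z / q ^ ((m - 1) * vec_size z)" if "z \<in> weyl_chamber m" for z
    using that assms(1) unfolding L_def M_def
    by (intro prod_inverse_power_differences) (auto simp: weyl_chamber_def)
  have fin: "finite ?S"
    by (rule finite_subset[of _ "{..<m} \<times> {..<m}"]) auto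
  have "M x \<noteq> 0"
  proof -
    have "q ^ (x $ j) - q ^ (x $ i) \<noteq> 0" if "i < j" "j < m" for i j
    proof -
      have "x $ j < x $ i"
        using that assms(4) by (simp add: weyl_chamber_def)
      then show ?thesis
        using power_strict_decreasing[OF _ assms(1,2)] by fastforce
    qed
    then show ?thesis
      using fin unfolding M_def by (subst prod_zero_iff) auto
  qed
  then have "L x \<noteq> 0"
    using assms(1,4) by (simp add: L)
  \<comment> \<open>Time is shifted by one to remove the truncated \<open>T - 1\<close>. The
    denominator has one more step, hence the extra \<open>r\<close>, which gives
    \<open>- (m choose 2)\<close> in the exponent.\<close>
  have "(\<lambda>T. F y T / (r * F x (Suc T))) \<longlonglongrightarrow> L y / (r * L x)"
    using r \<open>L x \<noteq> 0\<close> by (intro tendsto_intros F filterlim_compose[OF F filterlim_Suc]) auto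
  \<comment> \<open>If the determinant for \<open>x\<close> vanishes at some \<open>T\<close>, both
    quotients are 0 by convention, so the identity holds for every \<open>T\<close>.\<close>
  moreover have "F y T / (r * F x (Suc T)) = km_det q m (Suc T - 1) y / km_det q m (Suc T) x" for T
    using r C by (simp add: F_def field_simps)
  ultimately have "(\<lambda>T. km_det q m (T - 1) y / km_det q m T x) \<longlonglongrightarrow> L y / (r * L x)"
    by (subst filterlim_sequentially_Suc[symmetric]) simp
  also have "L y / (r * L x)
      = q ^ ((m - 1) * vec_size x) / (r * q ^ ((m - 1) * vec_size y)) * (M y / M x)"
    using assms(4,5) by (simp add: L mult_ac)
  also have "M y / M x = (\<Prod>(i, j)\<in>?S. (q ^ (y $ j) - q ^ (y $ i)) / (q ^ (x $ j) - q ^ (x $ i)))"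
    by (simp add: M_def case_prod_unfold prod_dividef)
  also have "q ^ ((m - 1) * vec_size x) / (r * q ^ ((m - 1) * vec_size y))
      = q powi (int ((m - 1) * vec_size x) - int ((m choose 2) + (m - 1) * vec_size y))"
    using assms(1) by (simp add: r_def power_int_diff power_add del: of_nat_add of_nat_mult)
  \<comment> \<open>Here \<open>m \<ge> 1\<close> turns the truncated \<open>m - 1\<close> into the
    integer \<open>int m - 1\<close>.\<close>
  also have "int ((m - 1) * vec_size x) - int ((m choose 2) + (m - 1) * vec_size y)
      = - int (m choose 2) + (int m - 1) * (int (vec_size x) - int (vec_size y))"
    unfolding of_nat_add of_nat_mult of_nat_diff[OF assms(3)] by (simp add: algebra_simps)
  finally show ?thesis .
qed

end
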